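(* Let $G_0=\mathbb{I}\oplus\mathbb{I}\ell$. For no pair $a,b\in S_{H_4}$ is the $\mathbb{Z}[\varphi]$-module $G_0+\mathbb{Z}[\varphi]v$ with $$v=\frac{a+b\ell}{2}$$ trace-integral.
   Context: Let $\varphi=(1+\sqrt5)/2$, $K=\mathbb{Q}(\sqrt5)$, and $\mathrm{Tr}_{K/\mathbb{Q}}$ the field trace. $\mathbb{H}(K)$ is the quaternion algebra over $K$ with basis $1,i,j,k$, $i^2=j^2=k^2=ijk=-1$, standard conjugation. The icosian ring $\mathbb{I}\subset\mathbb{H}(K)$ is the free $\mathbb{Z}[\varphi]$-module with basis $$e_1=1,\quad e_2=i,\quad e_3=\tfrac12(1+i+j+k),\quad e_4=\tfrac12(-1+(\varphi-1)i-\varphi j).$$ $S_{H_4}\subset\mathbb{I}$ is the set of $120$ norm-one quaternions $a+bi+cj+dk$ whose coordinate vector $(a,b,c,d)$ is one of: all permutations of $(\pm1,0,0,0)$; $\frac12(\pm1,\pm1,\pm1,\pm1)$ with all signs; all even permutations of $\frac12(0,\pm1,\pm\varphi,\pm\varphi^{-1})$ with all signs. $\mathbb{O}(K)=\mathbb{H}(K)\oplus\mathbb{H}(K)\ell$ is the Cayley--Dickson double with product $(a+b\ell)(c+d\ell)=(ac-\overline{d}b)+(da+b\overline{c})\ell$, conjugation $\overline{a+b\ell}=\overline{a}-b\ell$, and norm $N(x)=x\overline{x}$. The polar form is $B(x,y)=N(x+y)-N(x)-N(y)$. A $\mathbb{Z}[\varphi]$-module $G\subset\mathbb{O}(K)$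 is trace-integral if $\mathrm{Tr}_{K/\mathbb{Q}}N(x)\in\mathbb{Z}$ for all $x\in G$ and $\mathrm{Tr}_{K/\mathbb{Q}}B(x,y)\in\mathbb{Z}$ for all $x,y\in G$. *)

theory Defs
  imports Complex_Main "HOL-Computational_Algebra.Polynomial" "HOL-Combinatorics.Permutations"
begin

section \<open>The field $K = \mathbf{Q}(\sqrt 5)$\<close>

text \<open>\<open>QS x y\<close> stands for $x + y\sqrt5$ with rational $x$, $y$.\<close>

datatype qsqrt5 = QS (rat_part: rat) (sqrt5_part: rat)

lemma qsqrt5_eq_iff: "x = y \<longleftrightarrow> rat_part x = rat_part y \<and> sqrt5_part x = sqrt5_part y"
  by (cases x; cases y) auto

lemma rat_square_ne_5: "(q::rat)^2 \<noteq> 5"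
proof
  assume q: "q^2 = 5"
  obtain a b where ab: "q = Fract a b" "b > 0" "coprime a b"
    by (rule Rat_cases)
  then have "q = of_int a / of_int b"
    by (simp add: Fract_of_int_quotient)
  with q ab have "(of_int a :: rat)^2 = 5 * of_int b ^ 2"
    by (simp add: power_divide field_simps)
  then have eq: "a^2 = 5 * b^2"
    by (metis (mono_tags, lifting) of_int_eq_iff of_int_mult of_int_numeral of_int_power)
  have p5: "prime (5::int)"
    by simp
  from eq have "5 dvd a^2" by simp
  then have "5 dvd a" using p5 prime_dvd_power by blast
  then obtain c where c: "a = 5 * c" by blast
  with eq have "b^2 = 5 * c^2" by (simp add: power2_eq_square)
  then have "5 dvd b^2" by simp
  then have "5 dvd b" using p5 prime_dvd_power by blast
  with \<open>5 dvd a\<close> ab(3) show False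
    by (metis coprime_common_divisor_int abs_numeral numeral_eq_one_iff semiring_norm(86))
qed

lemma qsqrt5_norm_ne_0:
  assumes "(x::rat) \<noteq> 0 \<or> y \<noteq> 0" shows "x^2 - 5 * y^2 \<noteq> 0"
proof
  assume *: "x^2 - 5 * y^2 = 0"
  with assms have "y \<noteq> 0" by auto
  with * have "(x / y)^2 = 5" by (simp add: power_divide)
  then show False using rat_square_ne_5 by blast
qed

instantiation qsqrt5 :: field
begin

definition "0 = QS 0 0"
definition "1 = QS 1 0"
definition "x + y = QS (rat_part x + rat_part y) (sqrt5_part x + sqrt5_part y)"
definition "- x = QS (- rat_part x) (- sqrt5_part x)"
definition "x - y = QS (rat_part x - rat_part y) (sqrt5_part x - sqrt5_part y)"
definition "x * y = QS (rat_part x * rat_part y + 5 * (sqrt5_part x * sqrt5_part y))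
                       (rat_part x * sqrt5_part y + sqrt5_part x * rat_part y)"
definition "inverse x =
  (let n = rat_part x ^ 2 - 5 * sqrt5_part x ^ 2 in QS (rat_part x / n) (- sqrt5_part x / n))"
definition "x div y = x * inverse (y :: qsqrt5)"

instance
proof
  fix x :: qsqrt5
  assume "x \<noteq> 0"
  then have "rat_part x ^ 2 - 5 * sqrt5_part x ^ 2 \<noteq> 0"
    by (intro qsqrt5_norm_ne_0) (auto simp: qsqrt5_eq_iff zero_qsqrt5_def)
  then show "inverse x * x = 1"
    by (simp add: inverse_qsqrt5_def times_qsqrt5_def one_qsqrt5_def Let_def
        power2_eq_square flip: diff_divide_distrib)
qed (auto simp: qsqrt5_eq_iff zero_qsqrt5_def one_qsqrt5_def plus_qsqrt5_def uminus_qsqrt5_def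
      minus_qsqrt5_def times_qsqrt5_def inverse_qsqrt5_def divide_qsqrt5_def algebra_simps)

end

lemma qsqrt5_simps [simp]:
  "rat_part 0 = 0" "sqrt5_part 0 = 0" "rat_part 1 = 1" "sqrt5_part 1 = 0"
  "rat_part (x + y) = rat_part x + rat_part y" "sqrt5_part (x + y) = sqrt5_part x + sqrt5_part y"
  "rat_part (- x) = - rat_part x" "sqrt5_part (- x) = - sqrt5_part x"
  "rat_part (x - y) = rat_part x - rat_part y" "sqrt5_part (x - y) = sqrt5_part x - sqrt5_part y"
  "rat_part (x * y) = rat_part x * rat_part y + 5 * (sqrt5_part x * sqrt5_part y)"
  "sqrt5_part (x * y) = rat_part x * sqrt5_part y + sqrt5_part x * rat_part y"
  by (simp_all add: zero_qsqrt5_def one_qsqrt5_def plus_qsqrt5_def uminus_qsqrt5_def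
      minus_qsqrt5_def times_qsqrt5_def)

lemma of_nat_qsqrt5: "of_nat n = QS (of_nat n) 0"
  by (induction n) (auto simp: qsqrt5_eq_iff)

instance qsqrt5 :: field_char_0
  by standard (auto simp: inj_on_def of_nat_qsqrt5)

lemma of_int_qsqrt5: "of_int n = QS (of_int n) 0"
  by (cases n rule: int_diff_cases) (simp add: of_nat_qsqrt5 qsqrt5_eq_iff)

definition sqrt5 :: qsqrt5 where "sqrt5 = QS 0 1"

lemma sqrt5_squared: "sqrt5 ^ 2 = 5"
  using of_int_qsqrt5[of 5] by (simp add: sqrt5_def qsqrt5_eq_iff power2_eq_square)

text \<open>The trace of the $\mathbf{Q}$-linear map $y \mapsto xy$, computed in the basis $1, \sqrt5$.\<close>

definition trace_K :: "qsqrt5 \<Rightarrow> rat" where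
  "trace_K x = rat_part (x * 1) + sqrt5_part (x * sqrt5)"

lemma trace_K_eq: "trace_K x = 2 * rat_part x"
  by (simp add: trace_K_def sqrt5_def)

definition phi :: qsqrt5 where "phi = (1 + sqrt5) / 2"

lemma phi_squared: "phi ^ 2 = phi + 1"
  using sqrt5_squared by (simp add: phi_def field_simps power2_eq_square)

definition Z_phi :: "qsqrt5 set" where
  "Z_phi = range (\<lambda>p :: int poly. poly (map_poly of_int p) phi)"

lemma Z_phi_eq: "Z_phi = {of_int m + of_int n * phi |m n. True}"
proof (intro equalityI subsetI)
  fix x assume "x \<in> Z_phi"
  then obtain p :: "int poly" where x: "x = poly (map_poly of_int p) phi"
    by (auto simp: Z_phi_def)
  have "\<exists>m n. poly (map_poly of_int p) phi = of_int m + of_int n * phi"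
  proof (induction p)
    case 0
    show ?case by (intro exI[of _ 0]) simp
  next
    case (pCons a p)
    then obtain m n where "poly (map_poly of_int p) phi = of_int m + of_int n * phi" by blast
    then have "poly (map_poly of_int (pCons a p)) phi
        = of_int a + of_int m * phi + of_int n * phi ^ 2"
      by (simp add: map_poly_pCons power2_eq_square algebra_simps)
    also have "\<dots> = of_int (a + n) + of_int (m + n) * phi"
      by (simp add: phi_squared algebra_simps)
    finally show ?case by blast
  qed
  with x show "x \<in> {of_int m + of_int n * phi |m n. True}" by blast
next
  fix x assume "x \<in> {of_int m + of_int n * phi |m n. True}"
  then obtain m n where "x = of_int m + of_int n * phi" by blast
  then have "x = poly (map_poly of_int [:m, n:]) phi"
    by (simp add: map_poly_pCons)
  then show "x \<in> Z_phi" by (auto simp: Z_phi_def)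
qed

section \<open>Quaternions\<close>

text \<open>\<open>Quat a b c d\<close> stands for $a + bi + cj + dk$.\<close>

datatype 'a quat = Quat (Re_q: 'a) (Im_i: 'a) (Im_j: 'a) (Im_k: 'a)

lemma quat_eq_iff:
  "x = y \<longleftrightarrow> Re_q x = Re_q y \<and> Im_i x = Im_i y \<and> Im_j x = Im_j y \<and> Im_k x = Im_k y"
  by (cases x; cases y) auto

instantiation quat :: (comm_ring_1) ring_1
begin

definition "0 = Quat 0 0 0 0"
definition "1 = Quat 1 0 0 0"
definition "x + y = Quat (Re_q x + Re_q y) (Im_i x + Im_i y) (Im_j x + Im_j y) (Im_k x + Im_k y)"
definition "- x = Quat (- Re_q x) (- Im_i x) (- Im_j x) (- Im_k x)"
definition "x - y = Quat (Re_q x - Re_q y) (Im_i x - Im_i y) (Im_j x - Im_j y) (Im_k x - Im_k y)"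
definition "x * y = Quat
  (Re_q x * Re_q y - Im_i x * Im_i y - Im_j x * Im_j y - Im_k x * Im_k y)
  (Re_q x * Im_i y + Im_i x * Re_q y + Im_j x * Im_k y - Im_k x * Im_j y)
  (Re_q x * Im_j y - Im_i x * Im_k y + Im_j x * Re_q y + Im_k x * Im_i y)
  (Re_q x * Im_k y + Im_i x * Im_j y - Im_j x * Im_i y + Im_k x * Re_q y)"

instance
  by standard (auto simp: quat_eq_iff zero_quat_def one_quat_def plus_quat_def uminus_quat_def
      minus_quat_def times_quat_def algebra_simps)

end

lemma quat_simps [simp]:
  "Re_q 0 = 0" "Im_i 0 = 0" "Im_j 0 = 0" "Im_k 0 = 0"
  "Re_q 1 = 1" "Im_i 1 = 0" "Im_j 1 = 0" "Im_k 1 = 0"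
  "Re_q (x + y) = Re_q x + Re_q y" "Im_i (x + y) = Im_i x + Im_i y"
  "Im_j (x + y) = Im_j x + Im_j y" "Im_k (x + y) = Im_k x + Im_k y"
  "Re_q (- x) = - Re_q x" "Im_i (- x) = - Im_i x" "Im_j (- x) = - Im_j x" "Im_k (- x) = - Im_k x"
  "Re_q (x - y) = Re_q x - Re_q y" "Im_i (x - y) = Im_i x - Im_i y"
  "Im_j (x - y) = Im_j x - Im_j y" "Im_k (x - y) = Im_k x - Im_k y"
  "Re_q (x * y) = Re_q x * Re_q y - Im_i x * Im_i y - Im_j x * Im_j y - Im_k x * Im_k y"
  "Im_i (x * y) = Re_q x * Im_i y + Im_i x * Re_q y + Im_j x * Im_k y - Im_k x * Im_j y"
  "Im_j (x * y) = Re_q x * Im_j y - Im_i x * Im_k y + Im_j x * Re_q y + Im_k x * Im_i y"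
  "Im_k (x * y) = Re_q x * Im_k y + Im_i x * Im_j y - Im_j x * Im_i y + Im_k x * Re_q y"
  by (simp_all add: zero_quat_def one_quat_def plus_quat_def uminus_quat_def minus_quat_def
      times_quat_def)

definition quat_i :: "'a::comm_ring_1 quat" where "quat_i = Quat 0 1 0 0"
definition quat_j :: "'a::comm_ring_1 quat" where "quat_j = Quat 0 0 1 0"
definition quat_k :: "'a::comm_ring_1 quat" where "quat_k = Quat 0 0 0 1"

lemma quat_relations:
  "quat_i * quat_i = -1" "quat_j * quat_j = -1" "quat_k * quat_k = -1"
  "quat_i * quat_j * quat_k = -1"
  by (simp_all add: quat_eq_iff quat_i_def quat_j_def quat_k_def)

definition scale_q :: "'a::comm_ring_1 \<Rightarrow> 'a quat \<Rightarrow> 'a quat" (infixr \<open>*\<^sub>q\<close> 75) where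
  "r *\<^sub>q x = Quat (r * Re_q x) (r * Im_i x) (r * Im_j x) (r * Im_k x)"

lemma scale_q_simps [simp]:
  "Re_q (r *\<^sub>q x) = r * Re_q x" "Im_i (r *\<^sub>q x) = r * Im_i x"
  "Im_j (r *\<^sub>q x) = r * Im_j x" "Im_k (r *\<^sub>q x) = r * Im_k x"
  by (simp_all add: scale_q_def)

lemma Quat_expand: "Quat a b c d = a *\<^sub>q 1 + b *\<^sub>q quat_i + c *\<^sub>q quat_j + d *\<^sub>q quat_k"
  by (simp add: quat_eq_iff quat_i_def quat_j_def quat_k_def)

definition cnj_q :: "'a::comm_ring_1 quat \<Rightarrow> 'a quat" where
  "cnj_q x = Quat (Re_q x) (- Im_i x) (- Im_j x) (- Im_k x)"

lemma cnj_q_simps [simp]: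
  "Re_q (cnj_q x) = Re_q x" "Im_i (cnj_q x) = - Im_i x"
  "Im_j (cnj_q x) = - Im_j x" "Im_k (cnj_q x) = - Im_k x"
  by (simp_all add: cnj_q_def)

section \<open>Icosians and the 120 units\<close>

definition e1 :: "qsqrt5 quat" where "e1 = 1"
definition e2 :: "qsqrt5 quat" where "e2 = quat_i"
definition e3 :: "qsqrt5 quat" where "e3 = (1/2) *\<^sub>q (1 + quat_i + quat_j + quat_k)"
definition e4 :: "qsqrt5 quat" where
  "e4 = (1/2) *\<^sub>q (- 1 + (phi - 1) *\<^sub>q quat_i - phi *\<^sub>q quat_j)"

definition icosians :: "qsqrt5 quat set" where
  "icosians = {r1 *\<^sub>q e1 + r2 *\<^sub>q e2 + r3 *\<^sub>q e3 + r4 *\<^sub>q e4 |r1 r2 r3 r4.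
     r1 \<in> Z_phi \<and> r2 \<in> Z_phi \<and> r3 \<in> Z_phi \<and> r4 \<in> Z_phi}"

lemma icosian_basis_independent:
  assumes "r1 *\<^sub>q e1 + r2 *\<^sub>q e2 + r3 *\<^sub>q e3 + r4 *\<^sub>q e4 = 0"
  shows "r1 = 0 \<and> r2 = 0 \<and> r3 = 0 \<and> r4 = 0"
proof -
  have "phi \<noteq> 0" using phi_squared by auto
  with assms show ?thesis
    by (auto simp: quat_eq_iff e1_def e2_def e3_def e4_def quat_i_def quat_j_def quat_k_def)
qed

text \<open>\<open>perm_quat p [x0, x1, x2, x3]\<close> has the coordinates of the list rearranged by the
  permutation \<open>p\<close> of $\{0,1,2,3\}$. Replacing \<open>p\<close> by its inverse does not change its parity, so
  the choice of action is immaterial below.\<close>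

definition perm_quat :: "(nat \<Rightarrow> nat) \<Rightarrow> 'a list \<Rightarrow> 'a quat" where
  "perm_quat p xs = Quat (xs ! p 0) (xs ! p 1) (xs ! p 2) (xs ! p 3)"

definition S_H4 :: "qsqrt5 quat set" where
  "S_H4 =
     {perm_quat p [s, 0, 0, 0] |p s. p permutes {..<4} \<and> s \<in> {1, -1}} \<union>
     {(1/2) *\<^sub>q Quat s1 s2 s3 s4 |s1 s2 s3 s4.
        s1 \<in> {1, -1} \<and> s2 \<in> {1, -1} \<and> s3 \<in> {1, -1} \<and> s4 \<in> {1, -1}} \<union>
     {(1/2) *\<^sub>q perm_quat p [0, s1, s2 * phi, s3 * inverse phi] |p s1 s2 s3.
        p permutes {..<4} \<and> evenperm p \<and> s1 \<in> {1, -1} \<and> s2 \<in> {1, -1} \<and> s3 \<in> {1, -1}}"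

section \<open>The Cayley--Dickson double\<close>

text \<open>\<open>Oct a b\<close> stands for $a + b\ell$. The product is not associative, so only the additive
  structure is registered as a group.\<close>

datatype 'a oct = Oct (fst_o: "'a quat") (snd_o: "'a quat")

lemma oct_eq_iff: "x = y \<longleftrightarrow> fst_o x = fst_o y \<and> snd_o x = snd_o y"
  by (cases x; cases y) auto

instantiation oct :: (comm_ring_1) "{ab_group_add, one, times}"
begin

definition "0 = Oct 0 0"
definition "1 = Oct 1 0"
definition "x + y = Oct (fst_o x + fst_o y) (snd_o x + snd_o y)"
definition "- x = Oct (- fst_o x) (- snd_o x)"
definition "x - y = Oct (fst_o x - fst_o y) (snd_o x - snd_o y)"
definition "x * y = Oct (fst_o x * fst_o y - cnj_q (snd_o y) * snd_o x)
                        (snd_o y * fst_o x + snd_o x * cnj_q (fst_o y))"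

instance
  by standard (auto simp: oct_eq_iff zero_oct_def plus_oct_def uminus_oct_def minus_oct_def)

end

lemma oct_simps [simp]:
  "fst_o 0 = 0" "snd_o 0 = 0" "fst_o 1 = 1" "snd_o 1 = 0"
  "fst_o (x + y) = fst_o x + fst_o y" "snd_o (x + y) = snd_o x + snd_o y"
  "fst_o (- x) = - fst_o x" "snd_o (- x) = - snd_o x"
  "fst_o (x - y) = fst_o x - fst_o y" "snd_o (x - y) = snd_o x - snd_o y"
  "fst_o (x * y) = fst_o x * fst_o y - cnj_q (snd_o y) * snd_o x"
  "snd_o (x * y) = snd_o y * fst_o x + snd_o x * cnj_q (fst_o y)"
  by (simp_all add: zero_oct_def one_oct_def plus_oct_def uminus_oct_def minus_oct_def times_oct_def)

lemma Oct_expand: "Oct a b = Oct a 0 + Oct b 0 * Oct 0 1"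
  by (simp add: oct_eq_iff quat_eq_iff)

definition scale_o :: "'a::comm_ring_1 \<Rightarrow> 'a oct \<Rightarrow> 'a oct" (infixr \<open>*\<^sub>o\<close> 75) where
  "r *\<^sub>o x = Oct (r *\<^sub>q fst_o x) (r *\<^sub>q snd_o x)"

lemma scale_o_simps [simp]:
  "fst_o (r *\<^sub>o x) = r *\<^sub>q fst_o x" "snd_o (r *\<^sub>o x) = r *\<^sub>q snd_o x"
  by (simp_all add: scale_o_def)

definition cnj_o :: "'a::comm_ring_1 oct \<Rightarrow> 'a oct" where
  "cnj_o x = Oct (cnj_q (fst_o x)) (- snd_o x)"

text \<open>The product $x\overline{x}$ is a scalar; \<open>norm_o x\<close> is that scalar.\<close>

definition norm_o :: "'a::comm_ring_1 oct \<Rightarrow> 'a" where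
  "norm_o x = Re_q (fst_o (x * cnj_o x))"

lemma mult_cnj_o: "x * cnj_o x = norm_o x *\<^sub>o 1"
  by (simp add: norm_o_def cnj_o_def oct_eq_iff quat_eq_iff algebra_simps)

definition polar_o :: "'a::comm_ring_1 oct \<Rightarrow> 'a oct \<Rightarrow> 'a" where
  "polar_o x y = norm_o (x + y) - norm_o x - norm_o y"

section \<open>Modules over $\mathbf{Z}[\varphi]$ and trace-integrality\<close>

definition Z_phi_submodule :: "qsqrt5 oct set \<Rightarrow> bool" where
  "Z_phi_submodule G \<longleftrightarrow>
     0 \<in> G \<and> (\<forall>x\<in>G. \<forall>y\<in>G. x + y \<in> G) \<and> (\<forall>r\<in>Z_phi. \<forall>x\<in>G. r *\<^sub>o x \<in> G)"

text \<open>The notion is used for submodules only; being a submodule is not built into the predicate,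
  so that its negation does assert a failure of integrality.\<close>

definition trace_integral :: "qsqrt5 oct set \<Rightarrow> bool" where
  "trace_integral G \<longleftrightarrow>
     (\<forall>x\<in>G. trace_K (norm_o x) \<in> \<int>) \<and> (\<forall>x\<in>G. \<forall>y\<in>G. trace_K (polar_o x y) \<in> \<int>)"

definition G0 :: "qsqrt5 oct set" where
  "G0 = {Oct a b |a b. a \<in> icosians \<and> b \<in> icosians}"

text \<open>The module $G + \mathbf{Z}[\varphi]v$.\<close>

definition adjoin :: "qsqrt5 oct set \<Rightarrow> qsqrt5 oct \<Rightarrow> qsqrt5 oct set" where
  "adjoin G v = {g + r *\<^sub>o v |g r. g \<in> G \<and> r \<in> Z_phi}"

lemma Z_phi_add: "r \<in> Z_phi \<Longrightarrow> s \<in> Z_phi \<Longrightarrow> r + s \<in> Z_phi"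
proof -
  assume "r \<in> Z_phi" "s \<in> Z_phi"
  then obtain m n m' n' where "r = of_int m + of_int n * phi" "s = of_int m' + of_int n' * phi"
    by (auto simp: Z_phi_eq)
  then have "r + s = of_int (m + m') + of_int (n + n') * phi" by (simp add: algebra_simps)
  then show ?thesis unfolding Z_phi_eq by blast
qed

lemma Z_phi_mult: "r \<in> Z_phi \<Longrightarrow> s \<in> Z_phi \<Longrightarrow> r * s \<in> Z_phi"
proof -
  assume "r \<in> Z_phi" "s \<in> Z_phi"
  then obtain m n m' n' where "r = of_int m + of_int n * phi" "s = of_int m' + of_int n' * phi"
    by (auto simp: Z_phi_eq)
  then have "r * s = of_int (m * m') + of_int (m * n' + n * m') * phi + of_int (n * n') * phi ^ 2"
    by (simp add: algebra_simps power2_eq_square)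
  also have "\<dots> = of_int (m * m' + n * n') + of_int (m * n' + n * m' + n * n') * phi"
    by (simp add: phi_squared algebra_simps)
  finally show ?thesis unfolding Z_phi_eq by blast
qed

lemma Z_phi_of_int: "of_int m \<in> Z_phi"
  unfolding Z_phi_eq by (metis (mono_tags, lifting) add_0_right mem_Collect_eq mult_zero_left of_int_0)

lemma Z_phi_0: "0 \<in> Z_phi" and Z_phi_1: "1 \<in> Z_phi"
  using Z_phi_of_int[of 0] Z_phi_of_int[of 1] by simp_all

lemma icosians_closed:
  "0 \<in> icosians"
  "x \<in> icosians \<Longrightarrow> y \<in> icosians \<Longrightarrow> x + y \<in> icosians"
  "r \<in> Z_phi \<Longrightarrow> x \<in> icosians \<Longrightarrow> r *\<^sub>q x \<in> icosians"
proof -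
  have "0 = 0 *\<^sub>q e1 + 0 *\<^sub>q e2 + 0 *\<^sub>q e3 + 0 *\<^sub>q e4"
    by (simp add: quat_eq_iff)
  then show "0 \<in> icosians"
    unfolding icosians_def using Z_phi_0 by blast
next
  assume "x \<in> icosians" "y \<in> icosians"
  then obtain a b c d a' b' c' d' where
    "x = a *\<^sub>q e1 + b *\<^sub>q e2 + c *\<^sub>q e3 + d *\<^sub>q e4"
    "y = a' *\<^sub>q e1 + b' *\<^sub>q e2 + c' *\<^sub>q e3 + d' *\<^sub>q e4"
    and Z: "a \<in> Z_phi" "b \<in> Z_phi" "c \<in> Z_phi" "d \<in> Z_phi"
      "a' \<in> Z_phi" "b' \<in> Z_phi" "c' \<in> Z_phi" "d' \<in> Z_phi"
    unfolding icosians_def by blast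
  then have "x + y = (a + a') *\<^sub>q e1 + (b + b') *\<^sub>q e2 + (c + c') *\<^sub>q e3 + (d + d') *\<^sub>q e4"
    by (simp add: quat_eq_iff ring_distribs)
  then show "x + y \<in> icosians"
    unfolding icosians_def using Z Z_phi_add by blast
next
  assume r: "r \<in> Z_phi" and "x \<in> icosians"
  then obtain a b c d where "x = a *\<^sub>q e1 + b *\<^sub>q e2 + c *\<^sub>q e3 + d *\<^sub>q e4"
    and Z: "a \<in> Z_phi" "b \<in> Z_phi" "c \<in> Z_phi" "d \<in> Z_phi"
    unfolding icosians_def by blast
  then have "r *\<^sub>q x = (r * a) *\<^sub>q e1 + (r * b) *\<^sub>q e2 + (r * c) *\<^sub>q e3 + (r * d) *\<^sub>q e4"
    by (simp add: quat_eq_iff ring_distribs mult.assoc)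
  then show "r *\<^sub>q x \<in> icosians"
    unfolding icosians_def using Z r Z_phi_mult by blast
qed

lemma Z_phi_submodule_G0: "Z_phi_submodule G0"
  unfolding Z_phi_submodule_def G0_def
  by (auto simp: oct_eq_iff icosians_closed)

lemma Z_phi_submodule_adjoin:
  assumes "Z_phi_submodule G" shows "Z_phi_submodule (adjoin G v)"
  unfolding Z_phi_submodule_def
proof (intro conjI ballI)
  have "0 = 0 + 0 *\<^sub>o v" by (simp add: oct_eq_iff quat_eq_iff)
  then show "0 \<in> adjoin G v"
    using assms Z_phi_0 unfolding adjoin_def Z_phi_submodule_def by blast
next
  fix x y assume "x \<in> adjoin G v" "y \<in> adjoin G v"
  then obtain g h r s where "x = g + r *\<^sub>o v" "y = h + s *\<^sub>o v"
    and *: "g \<in> G" "h \<in> G" "r \<in> Z_phi" "s \<in> Z_phi"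
    unfolding adjoin_def by blast
  then have "x + y = (g + h) + (r + s) *\<^sub>o v"
    by (simp add: oct_eq_iff quat_eq_iff ring_distribs)
  then show "x + y \<in> adjoin G v"
    using assms * Z_phi_add unfolding adjoin_def Z_phi_submodule_def by blast
next
  fix r x assume r: "r \<in> Z_phi" and "x \<in> adjoin G v"
  then obtain g s where "x = g + s *\<^sub>o v" and *: "g \<in> G" "s \<in> Z_phi"
    unfolding adjoin_def by blast
  then have "r *\<^sub>o x = r *\<^sub>o g + (r * s) *\<^sub>o v"
    by (simp add: oct_eq_iff quat_eq_iff ring_distribs mult.assoc)
  then show "r *\<^sub>o x \<in> adjoin G v"
    using assms r * Z_phi_mult unfolding adjoin_def Z_phi_submodule_def by blast
qed

end

theory Submission
  imports Defs
begin

text \<open>The generator v itself causes no trouble: N(v) = (1 + 1)/4 = 1/2 has trace 1. But the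
  module is closed under multiplication by phi, and N(phi v) = phi^2/2 = (3 + sqrt 5)/4 has trace
  3/2, not an integer. This uses only that a and b have norm one (\<open>norm_q_S_H4\<close>), that
  the norm is additive over the two summands (\<open>norm_o_Oct\<close>) and that it is quadratic
  (\<open>norm_o_scale\<close>).\<close>

text \<open>All elements of \<open>S_H4\<close> have norm one, so $N(\varphi v) = \varphi^2 / 2$,
  which has trace $3/2$.\<close>

definition norm_q :: "'a::comm_ring_1 quat \<Rightarrow> 'a" where
  "norm_q x = (Re_q x)\<^sup>2 + (Im_i x)\<^sup>2 + (Im_j x)\<^sup>2 + (Im_k x)\<^sup>2"

lemma norm_q_scale: "norm_q (r *\<^sub>q x) = r\<^sup>2 * norm_q x"
  by (simp add: norm_q_def algebra_simps power_mult_distrib)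

text \<open>The first component of the product of a + bl with its conjugate is a times conj(a) plus
  conj(b) times b, with no cross terms.\<close>

lemma norm_o_Oct: "norm_o (Oct a b) = norm_q a + norm_q b"
  by (simp add: norm_o_def cnj_o_def norm_q_def power2_eq_square algebra_simps)

lemma norm_o_scale: "norm_o (r *\<^sub>o x) = r\<^sup>2 * norm_o x"
  by (cases x) (simp add: scale_o_def norm_o_Oct norm_q_scale algebra_simps)

lemma norm_q_perm_quat:
  assumes "p permutes {..<4}"
  shows "norm_q (perm_quat p [w, x, y, z]) = w\<^sup>2 + x\<^sup>2 + y\<^sup>2 + z\<^sup>2"
proof -
  let ?f = "\<lambda>i. ([w, x, y, z] ! i)\<^sup>2"
  have "norm_q (perm_quat p [w, x, y, z]) = (\<Sum>i<4. ?f (p i))"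
    by (simp add: norm_q_def perm_quat_def eval_nat_numeral)
  also have "\<dots> = (\<Sum>i<4. ?f i)"
    using sum.permute[OF assms, of ?f] by (simp add: o_def)
  also have "\<dots> = w\<^sup>2 + x\<^sup>2 + y\<^sup>2 + z\<^sup>2"
    by (simp add: eval_nat_numeral)
  finally show ?thesis .
qed

lemma inverse_phi: "inverse phi = phi - 1"
proof (rule inverse_unique)
  show "phi * (phi - 1) = 1"
    using phi_squared by (simp add: power2_eq_square algebra_simps)
qed

lemma norm_q_S_H4:
  assumes "a \<in> S_H4"
  shows "norm_q a = 1"
proof -
  \<comment> \<open>This handles the third family: its squared coordinates, before halving, sum to
    4, which cancels the factor (1/2)^2.\<close>
  have "phi\<^sup>2 + (phi - 1)\<^sup>2 = 3"
    by (simp add: power2_diff phi_squared)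
  then have "1 + phi\<^sup>2 + (inverse phi)\<^sup>2 = 4"
    by (simp add: inverse_phi add.assoc)
  then show ?thesis
    using assms unfolding S_H4_def
    by (auto simp: norm_q_scale norm_q_perm_quat power_mult_distrib)
      (auto simp: norm_q_def power2_eq_square)
qed

lemma phi_in_Z_phi: "phi \<in> Z_phi"
  unfolding Z_phi_eq by (intro CollectI exI[of _ 0] exI[of _ 1]) simp

lemma three_halves_not_Int: "(3 / 2 :: rat) \<notin> \<int>"
proof
  assume "(3 / 2 :: rat) \<in> \<int>"
  then obtain n where "(3 / 2 :: rat) = of_int n"
    by (elim Ints_cases)
  then have "(of_int 3 :: rat) = of_int (2 * n)"
    by simp
  then have "3 = 2 * n"
    by (simp only: of_int_eq_iff)
  then show False
    by presburger
qed

theorem proposition6p18: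
  "\<not> (\<exists>a\<in>S_H4. \<exists>b\<in>S_H4. trace_integral (adjoin G0 ((1/2) *\<^sub>o Oct a b)))"
proof (intro notI, elim bexE)
  fix a b
  assume a: "a \<in> S_H4" and b: "b \<in> S_H4"
    and int: "trace_integral (adjoin G0 ((1/2) *\<^sub>o Oct a b))"
  let ?v = "(1/2) *\<^sub>o Oct a b"
  \<comment> \<open>The summand 0 from \<open>G0\<close> matches the form g + r v in
    \<open>adjoin\<close>.\<close>
  have "0 + phi *\<^sub>o ?v \<in> adjoin G0 ?v"
    using Z_phi_submodule_G0 phi_in_Z_phi
    unfolding adjoin_def Z_phi_submodule_def by blast
  then have "trace_K (norm_o (phi *\<^sub>o ?v)) \<in> \<int>"
    using int by (simp add: trace_integral_def)
  moreover have "norm_o (phi *\<^sub>o ?v) = (phi + 1) / 2"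
    by (simp add: norm_o_scale norm_o_Oct norm_q_S_H4 a b phi_squared power_divide)
  moreover have "(phi + 1) / 2 = QS (3/4) (1/4)"
  proof -
    \<comment> \<open>With numerals as explicit pairs, both sides can be compared coordinatewise
      once denominators are cleared.\<close>
    have "2 = QS 2 0" "3 = QS 3 0" "4 = QS 4 0"
      using of_int_qsqrt5[of 2] of_int_qsqrt5[of 3] of_int_qsqrt5[of 4] by simp_all
    then show ?thesis
      by (simp add: phi_def field_simps) (simp add: qsqrt5_eq_iff sqrt5_def)
  qed
  ultimately show False
    using three_halves_not_Int by (simp add: trace_K_eq)
qed

end
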